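(* Let $X$ be a separable Banach space, $Y$ a Banach space, $G \subset X$ an open set, and $f: G \to Y$ a mapping. For $x \in G$ let $V_x$ be the set of those directions $u \in X$ in which the one-sided Hadamard directional derivative $f'_{H+}(x,u)$ exists. Then there exists a $\sigma$-directionally porous set $D \subset G$ such that for every $x \in G \setminus D$, either $V_x$ is empty, or $V_x$ is a closed linear subspace of $X$ and the mapping $u \mapsto f'_{H+}(x,u)$ is linear on $V_x$.
   Context: All Banach spaces are real. $B(x,r)$ denotes the open ball with center $x$ and radius $r$. Directional porosity: a set $A \subset X$ is directionally porous at a point $x \in X$ if there exist $0 \neq v \in X$, $p>0$ and a sequence $t_n \to 0$ of positive real numbers such that $B(x+t_n v, p t_n) \cap A = \emptyset$ for every $n$. The set $A$ is directionally porous if it is directionally porous at each point $x \in A$, and $\sigma$-directionally porous if it is a countable union of directionally porous sets. One-sided Hadamard directional derivative of $f$ at $x \in G$ in the direction $v \in X$: $$f'_{H+}(x,v) := \lim_{z \to v,\ t \to 0+} \frac{f(x+tz)-f(x)}{t}$$ (limit in the norm of $Y$, over pairs $(z,t)$ with $z \in X$, $t>0$; $z=v$ is allowed). It exists if this limit exists in $Y$. *)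

theory Defs
  imports "HOL-Analysis.Analysis"
begin

definition directionally_porous_at :: "'a::real_normed_vector set \<Rightarrow> 'a \<Rightarrow> bool" where
  "directionally_porous_at A x \<longleftrightarrow>
     (\<exists>v p (t :: nat \<Rightarrow> real). v \<noteq> 0 \<and> p > 0 \<and> (\<forall>n. t n > 0) \<and> t \<longlonglongrightarrow> 0 \<and>
        (\<forall>n. ball (x + t n *\<^sub>R v) (p * t n) \<inter> A = {}))"

definition directionally_porous :: "'a::real_normed_vector set \<Rightarrow> bool" where
  "directionally_porous A \<longleftrightarrow> (\<forall>x\<in>A. directionally_porous_at A x)"

definition sigma_directionally_porous :: "'a::real_normed_vector set \<Rightarrow> bool" where
  "sigma_directionally_porous D \<longleftrightarrow>
     (\<exists>A :: nat \<Rightarrow> 'a set. (\<forall>n. directionally_porous (A n)) \<and> D = (\<Union>n. A n))"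

(* The limit is taken over pairs (z, t) with z \<rightarrow> v and t \<rightarrow> 0+; the filter is nhds v and not
   at v, so z = v is allowed.  If x is interior to G, then x + t z lies in G for all (z, t)
   in a set of the filter, so only the values of f on G enter here. *)
definition has_hadamard_deriv_plus ::
    "('a::real_normed_vector \<Rightarrow> 'b::real_normed_vector) \<Rightarrow> 'a \<Rightarrow> 'a \<Rightarrow> 'b \<Rightarrow> bool" where
  "has_hadamard_deriv_plus f x v l \<longleftrightarrow>
     ((\<lambda>(z, t). (f (x + t *\<^sub>R z) - f x) /\<^sub>R t) \<longlongrightarrow> l) (nhds v \<times>\<^sub>F at_right (0::real))"

(* Meaningful only for v in hadamard_directions f x. *)
definition hadamard_deriv_plus ::
    "('a::real_normed_vector \<Rightarrow> 'b::real_normed_vector) \<Rightarrow> 'a \<Rightarrow> 'a \<Rightarrow> 'b" where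
  "hadamard_deriv_plus f x v = (THE l. has_hadamard_deriv_plus f x v l)"

(* The set V_x. *)
definition hadamard_directions ::
    "('a::real_normed_vector \<Rightarrow> 'b::real_normed_vector) \<Rightarrow> 'a \<Rightarrow> 'a set" where
  "hadamard_directions f x = {v. \<exists>l. has_hadamard_deriv_plus f x v l}"

(* The library's linear concerns maps on a whole type; this is linearity of the restriction
   of g to a linear subspace V. *)
definition linear_on_subspace ::
    "'a::real_vector set \<Rightarrow> ('a \<Rightarrow> 'b::real_vector) \<Rightarrow> bool" where
  "linear_on_subspace V g \<longleftrightarrow>
     (\<forall>u\<in>V. \<forall>w\<in>V. g (u + w) = g u + g w) \<and> (\<forall>c. \<forall>u\<in>V. g (c *\<^sub>R u) = c *\<^sub>R g u)"

end

theory Submission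
  imports Defs
begin

text \<open>If \<open>x\<close> is not a porosity point of \<open>A\<close>, then \<open>A\<close> meets \<open>B(x + t v, p t)\<close> for all small
  \<open>t\<close>, whatever \<open>v\<close> and \<open>p\<close>.  Discarding from countably many sets their points of porosity, we may
  assume this at \<open>x\<close> for each of these sets that contains \<open>x\<close>.  If \<open>f\<close> has a derivative at \<open>x\<close> in
  some direction, it is bounded on a cone at \<open>x\<close>, and nearby points with the same bound make \<open>f\<close>
  pointwise Lipschitz at \<open>x\<close>.  Nearby points that share this Lipschitz bound make the difference
  quotients at \<open>x\<close> asymptotically equicontinuous in the direction: Hadamard and ordinary directional
  derivatives coincide and \<open>V\<^sub>x\<close> is closed.  Finally, nearby points at which \<open>f\<close> is
  approximately differentiable in the direction \<open>u\<close> give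
  \<open>f (x + t (u + w)) - f (x + t w) = t f'(x, u) + o(t)\<close> for every \<open>w\<close>; taking \<open>w \<in> V\<^sub>x\<close> yields
  additivity and \<open>w = -u\<close> yields the derivative in the direction \<open>-u\<close>.\<close>

section \<open>Point sets with uniform local bounds\<close>

definition cone_bounded ::
    "('a::real_normed_vector \<Rightarrow> 'b::real_normed_vector) \<Rightarrow> 'a \<Rightarrow> real \<Rightarrow> real \<Rightarrow> 'a set" where
  "cone_bounded f d r C =
     {x. \<forall>z\<in>ball d r. \<forall>t\<in>{0<..<r}. norm (f (x + t *\<^sub>R z) - f x) \<le> C * t}"

text \<open>The vector \<open>y\<close> is chosen separately at each point \<open>x\<close>. Nearby
  members need not share an approximate derivative, and no countable supply of values
  \<open>y\<close> is needed for indexing.\<close>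

definition cone_approx ::
    "('a::real_normed_vector \<Rightarrow> 'b::real_normed_vector) \<Rightarrow> 'a \<Rightarrow> real \<Rightarrow> real \<Rightarrow> 'a set" where
  "cone_approx f d r e =
     {x. \<exists>y. \<forall>z\<in>ball d r. \<forall>t\<in>{0<..<r}. norm (f (x + t *\<^sub>R z) - f x - t *\<^sub>R y) \<le> e * t}"

definition lipschitz_points ::
    "('a::real_normed_vector \<Rightarrow> 'b::real_normed_vector) \<Rightarrow> real \<Rightarrow> real \<Rightarrow> 'a set" where
  "lipschitz_points f r C = {x. \<forall>h\<in>ball 0 r. norm (f (x + h) - f x) \<le> C * norm h}"

text \<open>Asymptotic equicontinuity at each \<open>v\<close>, as \<open>t\<close> tends to 0 from
  the right, of the difference quotients regarded as functions of the direction
  \<open>z\<close>.\<close>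

definition small_oscillation_at ::
    "('a::real_normed_vector \<Rightarrow> 'b::real_normed_vector) \<Rightarrow> 'a \<Rightarrow> bool" where
  "small_oscillation_at f x \<longleftrightarrow>
     (\<forall>v. \<forall>e>0. \<exists>p>0. \<forall>\<^sub>F t in at_right 0.
        \<forall>z\<in>ball v p. norm (f (x + t *\<^sub>R z) - f (x + t *\<^sub>R v)) \<le> e * t)"

lemma cone_boundedD:
  "x \<in> cone_bounded f d r C \<Longrightarrow> z \<in> ball d r \<Longrightarrow> 0 < t \<Longrightarrow> t < r \<Longrightarrow>
    norm (f (x + t *\<^sub>R z) - f x) \<le> C * t"
  by (simp add: cone_bounded_def)

lemma small_oscillation_atD:
  assumes "small_oscillation_at f x" "e > 0"
  obtains p where "p > 0" "\<forall>\<^sub>F t in at_right 0.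
        \<forall>z\<in>ball v p. norm (f (x + t *\<^sub>R z) - f (x + t *\<^sub>R v)) \<le> e * t"
  using assms unfolding small_oscillation_at_def by blast

lemma norm_add3_le:
  "norm a \<le> p \<Longrightarrow> norm b \<le> q \<Longrightarrow> norm c \<le> r \<Longrightarrow> norm (a + b + c) \<le> p + q + r"
  by norm

section \<open>Directional porosity\<close>

text \<open>If the eventual statement failed, empty balls would occur at arbitrarily small
  \<open>t\<close>; choosing \<open>t n\<close> below \<open>1 / (n + 1)\<close> would give a
  sequence witnessing porosity.\<close>

lemma not_directionally_porous_at_meets:
  fixes A :: "'a::real_normed_vector set"
  assumes "\<not> directionally_porous_at A x" "v \<noteq> 0" "p > 0"
  shows "\<forall>\<^sub>F t in at_right 0. \<exists>a\<in>A. dist (x + t *\<^sub>R v) a < p * t"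
proof (rule ccontr)
  assume "\<not> ?thesis"
  then have "\<exists>t>0. t < b \<and> ball (x + t *\<^sub>R v) (p * t) \<inter> A = {}" if "b > 0" for b
    using that unfolding eventually_at_right_field by fastforce
  then have "\<exists>t>0. t < inverse (real (Suc n)) \<and> ball (x + t *\<^sub>R v) (p * t) \<inter> A = {}" for n
    by simp
  then obtain t where t: "\<And>n. t n > 0" "\<And>n. t n < inverse (real (Suc n))"
      "\<And>n. ball (x + t n *\<^sub>R v) (p * t n) \<inter> A = {}"
    by metis
  have "t \<longlonglongrightarrow> 0"
    by (rule tendsto_sandwich[OF _ _ tendsto_const LIMSEQ_inverse_real_of_nat])
      (use t in \<open>auto intro!: always_eventually less_imp_le\<close>)
  then have "directionally_porous_at A x"
    unfolding directionally_porous_at_def using t assms by blast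
  with assms show False by blast
qed

text \<open>Porosity at a point passes to subsets, so the points of \<open>A\<close> at which
  \<open>A\<close> is porous form a directionally porous set. The map \<open>from_nat_into\<close>
  lists the nonempty countable family, possibly with repetitions.\<close>

lemma sigma_directionally_porous_Union:
  fixes F :: "'a::real_normed_vector set set"
  assumes "countable F" "F \<noteq> {}"
  shows "sigma_directionally_porous (G \<inter> (\<Union>A\<in>F. {x \<in> A. directionally_porous_at A x}))"
proof -
  have mono: "directionally_porous_at B x" if "directionally_porous_at A x" "B \<subseteq> A"
    for A B :: "'a set" and x
    using that unfolding directionally_porous_at_def by (meson disjoint_iff subsetD)
  define B where "B n = G \<inter> {x \<in> from_nat_into F n. directionally_porous_at (from_nat_into F n) x}" for n
  have "directionally_porous (B n)" for n
    unfolding directionally_porous_def B_def by (auto intro: mono)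
  moreover have "G \<inter> (\<Union>A\<in>F. {x \<in> A. directionally_porous_at A x}) = (\<Union>n. B n)"
    unfolding B_def Int_UN_distrib
    by (subst range_from_nat_into[OF assms(2,1), symmetric]) (simp only: image_image)
  ultimately show ?thesis
    unfolding sigma_directionally_porous_def by blast
qed

section \<open>Hadamard derivatives in epsilon form\<close>

lemma norm_diff_scaleR:
  assumes "t > 0"
  shows "norm (y - t *\<^sub>R l) = t * dist (y /\<^sub>R t) l"
proof -
  have "y - t *\<^sub>R l = t *\<^sub>R (y /\<^sub>R t - l)"
    using assms by (simp add: scaleR_diff_right)
  with assms show ?thesis by (simp add: dist_norm)
qed

text \<open>Rectangles form a base of the product filter, and both sides may shrink to their
  minimum, so one radius serves for \<open>z\<close> and \<open>t\<close>. Clearing the denominator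
  gives the inequality of \<open>cone_approx\<close> with \<open>y = l\<close>.\<close>

lemma has_hadamard_deriv_plus_iff:
  "has_hadamard_deriv_plus f x v l \<longleftrightarrow>
     (\<forall>e>0. \<exists>r>0. \<forall>z\<in>ball v r. \<forall>t\<in>{0<..<r}. norm (f (x + t *\<^sub>R z) - f x - t *\<^sub>R l) \<le> e * t)"
    (is "_ \<longleftrightarrow> ?R")
proof -
  show ?thesis
  proof
    assume h: "has_hadamard_deriv_plus f x v l"
    show ?R
    proof (intro allI impI)
      fix e :: real assume "e > 0"
      with h have "\<forall>\<^sub>F (z, t) in nhds v \<times>\<^sub>F at_right 0. dist ((f (x + t *\<^sub>R z) - f x) /\<^sub>R t) l < e"
        unfolding has_hadamard_deriv_plus_def tendsto_iff by (simp add: case_prod_unfold)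
      then obtain P Q where P: "\<forall>\<^sub>F z in nhds v. P z" and Q: "\<forall>\<^sub>F t in at_right 0. Q t"
        and PQ: "\<And>z t. P z \<Longrightarrow> Q t \<Longrightarrow> dist ((f (x + t *\<^sub>R z) - f x) /\<^sub>R t) l < e"
        unfolding eventually_prod_filter by auto
      from P obtain r1 where "r1 > 0" "\<And>z. dist z v < r1 \<Longrightarrow> P z"
        unfolding eventually_nhds_metric by auto
      moreover from Q obtain r2 where "r2 > 0" "\<And>t. 0 < t \<Longrightarrow> t < r2 \<Longrightarrow> Q t"
        unfolding eventually_at_right_field by auto
      ultimately have "\<forall>z\<in>ball v (min r1 r2). \<forall>t\<in>{0<..<min r1 r2}.
          norm (f (x + t *\<^sub>R z) - f x - t *\<^sub>R l) \<le> e * t"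
        using PQ by (auto simp: norm_diff_scaleR mult.commute dist_commute intro!: mult_left_mono less_imp_le)
      with \<open>r1 > 0\<close> \<open>r2 > 0\<close> show "\<exists>r>0. \<forall>z\<in>ball v r. \<forall>t\<in>{0<..<r}.
          norm (f (x + t *\<^sub>R z) - f x - t *\<^sub>R l) \<le> e * t"
        by (intro exI[of _ "min r1 r2"]) simp
    qed
  next
    assume R: ?R
    show "has_hadamard_deriv_plus f x v l"
      unfolding has_hadamard_deriv_plus_def tendsto_iff
    proof (intro allI impI)
      fix e :: real assume "e > 0"
      \<comment> \<open>Half of \<open>e\<close> turns the weak inequality of the increment form
        into the strict one required by \<open>tendsto_iff\<close>.\<close>
      then obtain r where r: "r > 0" "\<And>z t. dist z v < r \<Longrightarrow> 0 < t \<Longrightarrow> t < r \<Longrightarrow>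
          norm (f (x + t *\<^sub>R z) - f x - t *\<^sub>R l) \<le> e / 2 * t"
        using R[rule_format, of "e / 2"] by (auto simp: dist_commute)
      have "dist ((f (x + t *\<^sub>R z) - f x) /\<^sub>R t) l < e" if "dist z v < r" "0 < t" "t < r" for z t
      proof -
        have "t * dist ((f (x + t *\<^sub>R z) - f x) /\<^sub>R t) l \<le> t * (e / 2)"
          using r(2)[OF that] norm_diff_scaleR[OF that(2), of "f (x + t *\<^sub>R z) - f x" l] by (simp add: mult.commute)
        with \<open>e > 0\<close> \<open>0 < t\<close> show ?thesis by (simp only: mult_le_cancel_left_pos)
      qed
      moreover have "\<forall>\<^sub>F z in nhds v. dist z v < r"
        unfolding eventually_nhds_metric using \<open>r > 0\<close> by auto
      moreover have "\<forall>\<^sub>F t in at_right 0. 0 < t \<and> t < r"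
        unfolding eventually_at_right_field using \<open>r > 0\<close> by auto
      ultimately show "\<forall>\<^sub>F zt in nhds v \<times>\<^sub>F at_right 0.
          dist (case zt of (z, t) \<Rightarrow> (f (x + t *\<^sub>R z) - f x) /\<^sub>R t) l < e"
        unfolding eventually_prod_filter by (auto simp: case_prod_beta)
    qed
  qed
qed

text \<open>The filter \<open>nhds v\<close> admits \<open>z = v\<close>, so the limit over pairs
  restricts to the ray in direction \<open>v\<close>.\<close>

lemma has_hadamard_deriv_plus_tendsto:
  assumes "has_hadamard_deriv_plus f x v l"
  shows "((\<lambda>t. (f (x + t *\<^sub>R v) - f x) /\<^sub>R t) \<longlongrightarrow> l) (at_right 0)"
proof -
  have "filterlim (\<lambda>t::real. (v, t)) (nhds v \<times>\<^sub>F at_right 0) (at_right 0)"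
    by (intro filterlim_Pair) (auto simp: filterlim_ident)
  from filterlim_compose[OF assms[unfolded has_hadamard_deriv_plus_def] this] show ?thesis by simp
qed

lemma has_hadamard_deriv_plus_unique:
  assumes "has_hadamard_deriv_plus f x v l" "has_hadamard_deriv_plus f x v l'"
  shows "l = l'"
  using assms[THEN has_hadamard_deriv_plus_tendsto] by (rule tendsto_unique[rotated]) simp

lemma hadamard_deriv_plus_eqI:
  "has_hadamard_deriv_plus f x v l \<Longrightarrow> hadamard_deriv_plus f x v = l"
  unfolding hadamard_deriv_plus_def using has_hadamard_deriv_plus_unique by blast

lemma tendsto_quotient_iff:
  fixes g :: "real \<Rightarrow> 'b::real_normed_vector"
  shows "((\<lambda>t. g t /\<^sub>R t) \<longlongrightarrow> l) (at_right 0) \<longleftrightarrow>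
     (\<forall>e>0. \<forall>\<^sub>F t in at_right 0. norm (g t - t *\<^sub>R l) \<le> e * t)"
proof -
  have pos: "\<forall>\<^sub>F t in at_right 0. (0::real) < t"
    by (simp add: eventually_at_right_less)
  show ?thesis
  proof
    assume "((\<lambda>t. g t /\<^sub>R t) \<longlongrightarrow> l) (at_right 0)"
    then have "\<forall>\<^sub>F t in at_right 0. dist (g t /\<^sub>R t) l < e" if "e > 0" for e
      using that unfolding tendsto_iff by blast
    then show "\<forall>e>0. \<forall>\<^sub>F t in at_right 0. norm (g t - t *\<^sub>R l) \<le> e * t"
    proof (intro allI impI)
      fix e :: real
      assume "\<And>e. e > 0 \<Longrightarrow> \<forall>\<^sub>F t in at_right 0. dist (g t /\<^sub>R t) l < e" "e > 0"
      then have "\<forall>\<^sub>F t in at_right 0. dist (g t /\<^sub>R t) l < e" by blast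
      with pos show "\<forall>\<^sub>F t in at_right 0. norm (g t - t *\<^sub>R l) \<le> e * t"
        by eventually_elim (simp add: norm_diff_scaleR mult.commute)
    qed
  next
    assume R: "\<forall>e>0. \<forall>\<^sub>F t in at_right 0. norm (g t - t *\<^sub>R l) \<le> e * t"
    show "((\<lambda>t. g t /\<^sub>R t) \<longlongrightarrow> l) (at_right 0)"
      unfolding tendsto_iff
    proof (intro allI impI)
      fix e :: real assume e: "e > 0"
      then have "\<forall>\<^sub>F t in at_right 0. norm (g t - t *\<^sub>R l) \<le> e / 2 * t"
        using R half_gt_zero by blast
      with pos show "\<forall>\<^sub>F t in at_right 0. dist (g t /\<^sub>R t) l < e"
      proof eventually_elim
        case (elim t)
        then have "t * dist (g t /\<^sub>R t) l \<le> t * (e / 2)"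
          using norm_diff_scaleR[of t "g t" l] by (simp add: mult.commute)
        with e elim show ?case by (simp only: mult_le_cancel_left_pos)
      qed
    qed
  qed
qed

text \<open>Small oscillation bounds the effect of replacing \<open>v\<close> by a nearby
  \<open>z\<close> by \<open>e / 2 * t\<close>, so convergence along the ray already gives the limit
  over pairs.\<close>

lemma has_hadamard_deriv_plus_iff_tendsto:
  assumes osc: "small_oscillation_at f x"
  shows "has_hadamard_deriv_plus f x v l \<longleftrightarrow>
    ((\<lambda>t. (f (x + t *\<^sub>R v) - f x) /\<^sub>R t) \<longlongrightarrow> l) (at_right 0)"
proof
  assume lim: "((\<lambda>t. (f (x + t *\<^sub>R v) - f x) /\<^sub>R t) \<longlongrightarrow> l) (at_right 0)"
  show "has_hadamard_deriv_plus f x v l"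
    unfolding has_hadamard_deriv_plus_iff
  proof (intro allI impI)
    fix e :: real assume e: "e > 0"
    then have e2: "e / 2 > 0" by simp
    obtain p where p: "p > 0" "\<forall>\<^sub>F t in at_right 0.
        \<forall>z\<in>ball v p. norm (f (x + t *\<^sub>R z) - f (x + t *\<^sub>R v)) \<le> e / 2 * t"
      using small_oscillation_atD[OF osc e2] by blast
    have "\<forall>\<^sub>F t in at_right 0. norm (f (x + t *\<^sub>R v) - f x - t *\<^sub>R l) \<le> e / 2 * t"
      using lim e2 unfolding tendsto_quotient_iff by blast
    with p(2) have "\<forall>\<^sub>F t in at_right 0.
        \<forall>z\<in>ball v p. norm (f (x + t *\<^sub>R z) - f x - t *\<^sub>R l) \<le> e * t"
    proof eventually_elim
      case (elim t)
      show ?case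
      proof
        fix z assume "z \<in> ball v p"
        with elim show "norm (f (x + t *\<^sub>R z) - f x - t *\<^sub>R l) \<le> e * t"
          using norm_triangle_ineq[of "f (x + t *\<^sub>R z) - f (x + t *\<^sub>R v)" "f (x + t *\<^sub>R v) - f x - t *\<^sub>R l"]
          by (fastforce simp: algebra_simps)
      qed
    qed
    then obtain b where b: "b > 0" "\<And>t z. 0 < t \<Longrightarrow> t < b \<Longrightarrow> z \<in> ball v p \<Longrightarrow>
        norm (f (x + t *\<^sub>R z) - f x - t *\<^sub>R l) \<le> e * t"
      unfolding eventually_at_right_field by blast
    then show "\<exists>r>0. \<forall>z\<in>ball v r. \<forall>t\<in>{0<..<r}. norm (f (x + t *\<^sub>R z) - f x - t *\<^sub>R l) \<le> e * t"
      using p(1) by (intro exI[of _ "min b p"]) auto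
  qed
qed (rule has_hadamard_deriv_plus_tendsto)

section \<open>From a bounded cone to a Lipschitz bound and small oscillation\<close>

text \<open>Two points reached from \<open>x\<close> and from \<open>a \<approx> x - t d\<close> along directions close to \<open>d\<close>:
  \<open>x + h = a + t z\<close> and \<open>x + t d = a + 2 t z'\<close>.  So \<open>f (x + h)\<close> is linked to \<open>f x\<close> by the chain
  \<open>x + h, a, x + t d, x\<close>.\<close>
lemma cone_bounded_imp_lipschitz:
  assumes x: "x \<in> cone_bounded f d r C" and r: "r > 0" and C: "C \<ge> 0"
    and np: "\<not> directionally_porous_at (cone_bounded f d r C) x"
  shows "\<exists>s>0. \<exists>K\<ge>0. x \<in> lipschitz_points f s K"
proof (cases "d = 0")
  \<comment> \<open>A cone with axis 0 contains all directions, so the bound at \<open>x\<close>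
    alone suffices. The choice of \<open>t\<close> gives \<open>h / t\<close> norm
    \<open>r / 2\<close>, and \<open>norm h < r * r / 2\<close> means \<open>t < r\<close>.\<close>
  case True
  have "norm (f (x + h) - f x) \<le> (C * 2 / r) * norm h" if "norm h < r * r / 2" for h
  proof (cases "h = 0")
    case False
    define t where "t = 2 * norm h / r"
    have t: "0 < t" "t < r" using False r that by (auto simp: t_def field_simps)
    have "h /\<^sub>R t \<in> ball d r" using False True r by (simp add: t_def field_simps)
    then have "norm (f (x + t *\<^sub>R (h /\<^sub>R t)) - f x) \<le> C * t"
      using t by (intro cone_boundedD[OF x])
    then have "norm (f (x + h) - f x) \<le> C * t" using t by simp
    then show ?thesis by (simp add: t_def field_simps)
  qed simp
  then have "x \<in> lipschitz_points f (r * r / 2) (C * 2 / r)"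
    unfolding lipschitz_points_def by simp
  with r C show ?thesis by (intro exI[of _ "r * r / 2"] conjI exI[of _ "C * 2 / r"]) auto
next
  case False
  \<comment> \<open>Porosity is excluded along \<open>- d\<close>, so that \<open>d\<close> leads
    from \<open>a\<close> back towards \<open>x\<close>. The tolerance \<open>r / 4\<close> leaves
    room in the cone for \<open>h / t\<close>.\<close>
  then have "\<forall>\<^sub>F t in at_right 0. \<exists>a\<in>cone_bounded f d r C. dist (x + t *\<^sub>R (- d)) a < r / 4 * t"
    using r by (intro not_directionally_porous_at_meets[OF np]) auto
  then obtain b where b: "b > 0" "\<And>t. 0 < t \<Longrightarrow> t < b \<Longrightarrow>
      \<exists>a\<in>cone_bounded f d r C. dist (x + t *\<^sub>R (- d)) a < r / 4 * t"
    unfolding eventually_at_right_field by blast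
  \<comment> \<open>Makes \<open>t = 4 * norm h / r\<close> smaller than \<open>b\<close> and
    \<open>r / 2\<close>; the latter is needed for the step \<open>2 * t\<close>.\<close>
  define s where "s = min b (r / 2) * r / 4"
  have s: "s > 0" using b r by (simp add: s_def)
  have "norm (f (x + h) - f x) \<le> (16 * C / r) * norm h" if h: "norm h < s" for h
  proof (cases "h = 0")
    case False
    \<comment> \<open>Gives \<open>h / t\<close> norm \<open>r / 4\<close>. The chain costs
      \<open>4 * C * t\<close>, that is, \<open>16 * C / r\<close> times
      \<open>norm h\<close>.\<close>
    define t where "t = 4 * norm h / r"
    have "t < min b (r / 2)" using h unfolding t_def s_def pos_divide_less_eq[OF r] by linarith
    then have t: "0 < t" "t < b" "2 * t < r" using False r by (auto simp: t_def)
    then obtain a where a: "a \<in> cone_bounded f d r C" "dist (x + t *\<^sub>R (- d)) a < r / 4 * t"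
      using b by blast
    \<comment> \<open>The offset between \<open>x - t d\<close> and \<open>a\<close> in units of
      \<open>t\<close>. Seen from \<open>a\<close>, the points \<open>x + h\<close> and
      \<open>x + t d\<close> have directions \<open>d + q + h / t\<close> and
      \<open>d + q / 2\<close>, with steps \<open>t\<close> and \<open>2 * t\<close>.\<close>
    define q where "q = (x - t *\<^sub>R d - a) /\<^sub>R t"
    have tq: "t *\<^sub>R q = x - t *\<^sub>R d - a" using t by (simp add: q_def)
    then have "norm (t *\<^sub>R q) < r / 4 * t" using a(2) by (simp add: dist_norm)
    then have q: "norm q < r / 4" using t by (simp add: mult.commute)
    have aq: "x = a + t *\<^sub>R q + t *\<^sub>R d" by (simp add: tq)
    have hq: "norm (h /\<^sub>R t) = r / 4" using False r by (simp add: t_def field_simps)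
    have "norm (q + h /\<^sub>R t) < r" using q hq r norm_triangle_ineq[of q "h /\<^sub>R t"] by linarith
    then have "d + (q + h /\<^sub>R t) \<in> ball d r" by (simp add: dist_norm flip: norm_minus_cancel[of "q + _"])
    moreover have "a + t *\<^sub>R (d + (q + h /\<^sub>R t)) = x + h"
      using aq t by (simp add: algebra_simps)
    ultimately have 1: "norm (f (x + h) - f a) \<le> C * t"
      using cone_boundedD[OF a(1), of "d + (q + h /\<^sub>R t)" t] t by simp
    have "d + q /\<^sub>R 2 \<in> ball d r" using q r by (simp add: dist_norm)
    moreover have "a + (2 * t) *\<^sub>R (d + q /\<^sub>R 2) = x + t *\<^sub>R d"
      using aq t by (simp add: algebra_simps flip: scaleR_2)
    ultimately have 2: "norm (f (x + t *\<^sub>R d) - f a) \<le> C * (2 * t)"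
      using cone_boundedD[OF a(1), of "d + q /\<^sub>R 2" "2 * t"] t by simp
    have 3: "norm (f (x + t *\<^sub>R d) - f x) \<le> C * t"
      using t r by (intro cone_boundedD[OF x]) simp_all
    have "f (x + h) - f x = (f (x + h) - f a) + (f a - f (x + t *\<^sub>R d)) + (f (x + t *\<^sub>R d) - f x)"
      by simp
    then have "norm (f (x + h) - f x) \<le> C * t + C * (2 * t) + C * t"
      using norm_add3_le[OF 1 2[unfolded norm_minus_commute[of _ "f a"]] 3] by metis
    then show ?thesis by (simp add: t_def)
  qed simp
  then have "x \<in> lipschitz_points f s (16 * C / r)"
    unfolding lipschitz_points_def by simp
  with s r C show ?thesis by (intro exI[of _ s] conjI exI[of _ "16 * C / r"]) auto
qed

text \<open>Some \<open>a\<close> in the set lies within \<open>p t\<close> of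
  \<open>x + t v\<close>, hence within \<open>2 p t\<close> of each \<open>x + t z\<close> with
  \<open>z\<close> in \<open>ball v p\<close>. The Lipschitz bound at \<open>a\<close>, rather than
  at \<open>x\<close>, controls both values of \<open>f\<close>.\<close>

lemma lipschitz_points_imp_small_oscillation:
  assumes x: "x \<in> lipschitz_points f r C" and r: "r > 0" and C: "C \<ge> 0"
    and np: "\<not> directionally_porous_at (lipschitz_points f r C) x"
  shows "small_oscillation_at f x"
  unfolding small_oscillation_at_def
proof (intro allI impI)
  fix v :: 'a and e :: real assume e: "e > 0"
  \<comment> \<open>Each of the two comparisons with \<open>f a\<close> may cost
    \<open>e / 2 * t\<close>; \<open>C + 1\<close> avoids division by zero.\<close>
  define p where "p = e / (4 * (C + 1))"
  have p: "p > 0" and Cp: "4 * (C * p) \<le> e" using e C by (auto simp: p_def field_simps)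
  have C2: "C * (2 * p * t) \<le> e / 2 * t" if "t > 0" for t
    using mult_right_mono[OF Cp, of t] that by simp
  have small: "\<forall>\<^sub>F t in at_right 0. 0 < t \<and> 2 * p * t < r"
    unfolding eventually_at_right_field using p r
    by (intro exI[of _ "r / (2 * p)"]) (auto simp: field_simps)
  show "\<exists>p>0. \<forall>\<^sub>F t in at_right 0. \<forall>z\<in>ball v p. norm (f (x + t *\<^sub>R z) - f (x + t *\<^sub>R v)) \<le> e * t"
  proof (intro exI conjI)
    have "\<forall>\<^sub>F t in at_right 0. \<exists>a\<in>lipschitz_points f r C. dist (x + t *\<^sub>R v) a < p * t"
    proof (cases "v = 0")
      \<comment> \<open>Porosity concerns nonzero directions only; for \<open>v = 0\<close> the
        point \<open>x\<close> itself serves as \<open>a\<close>.\<close>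
      case True
      from small show ?thesis
      proof eventually_elim
        case (elim t)
        then show ?case using x p True by (intro bexI[of _ x]) auto
      qed
    next
      case False
      then show ?thesis by (intro not_directionally_porous_at_meets np p)
    qed
    with small show "\<forall>\<^sub>F t in at_right 0.
        \<forall>z\<in>ball v p. norm (f (x + t *\<^sub>R z) - f (x + t *\<^sub>R v)) \<le> e * t"
    proof eventually_elim
      case (elim t)
      then obtain a where a: "a \<in> lipschitz_points f r C" "dist (x + t *\<^sub>R v) a < p * t" by blast
      have *: "norm (f (x + t *\<^sub>R z) - f a) \<le> e / 2 * t" if "z \<in> ball v p" for z
      proof -
        have "norm (t *\<^sub>R (z - v)) \<le> p * t" using that elim
          by (simp add: dist_norm norm_minus_commute mult.commute)
        moreover have "x + t *\<^sub>R z - a = (x + t *\<^sub>R v - a) + t *\<^sub>R (z - v)" by (simp add: algebra_simps)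
        then have "norm (x + t *\<^sub>R z - a) \<le> norm (x + t *\<^sub>R v - a) + norm (t *\<^sub>R (z - v))"
          using norm_triangle_ineq by metis
        ultimately have n: "norm (x + t *\<^sub>R z - a) \<le> 2 * p * t"
          using a(2) unfolding dist_norm by linarith
        then have "x + t *\<^sub>R z - a \<in> ball 0 r" using elim by simp
        then have "norm (f (a + (x + t *\<^sub>R z - a)) - f a) \<le> C * norm (x + t *\<^sub>R z - a)"
          using a(1) unfolding lipschitz_points_def by blast
        also have "\<dots> \<le> C * (2 * p * t)" using n C by (rule mult_left_mono)
        also have "\<dots> \<le> e / 2 * t" using elim by (intro C2) simp
        finally show ?thesis by simp
      qed
      have "v \<in> ball v p" using p by simp
      note v = *[OF this]
      show ?case
      proof
        fix z assume "z \<in> ball v p"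
        from norm_triangle_le_diff[OF add_mono[OF *[OF this] v]]
        show "norm (f (x + t *\<^sub>R z) - f (x + t *\<^sub>R v)) \<le> e * t" by simp
      qed
    qed
  qed (rule p)
qed

section \<open>Increments in a direction of differentiability\<close>

text \<open>With \<open>a \<approx> x + t w\<close> and \<open>x + t (u + w) = a + t z\<close>, the increment is governed by the
  approximate derivative \<open>y\<close> at \<open>a\<close>.  Evaluating \<open>f\<close> at the fixed point \<open>x + s u\<close>, which lies in
  the cones of both \<open>a\<close> and \<open>x\<close>, shows that \<open>y\<close> is close to \<open>l\<close>; this is what makes separability
  of the target space unnecessary.\<close>
lemma hadamard_deriv_translate:
  assumes osc: "small_oscillation_at f x"
    and cont: "isCont f x"
    and l: "has_hadamard_deriv_plus f x u l"
    and np: "\<And>e. e > 0 \<Longrightarrow> \<exists>d r e'. r > 0 \<and> e' \<le> e \<and> u \<in> ball d r \<and>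
      x \<in> cone_approx f d r e' \<and> \<not> directionally_porous_at (cone_approx f d r e') x"
  shows "((\<lambda>t. (f (x + t *\<^sub>R (u + w)) - f (x + t *\<^sub>R w)) /\<^sub>R t) \<longlongrightarrow> l) (at_right 0)"
proof (cases "w = 0")
  case True
  then show ?thesis using has_hadamard_deriv_plus_tendsto[OF l] by simp
next
  case False
  show ?thesis unfolding tendsto_quotient_iff
  proof (intro allI impI)
    fix e0 :: real assume "e0 > 0"
    \<comment> \<open>The final estimate adds \<open>e\<close>, \<open>e\<close> and
      \<open>3 * e\<close>, which stays below \<open>6 * e\<close>.\<close>
    define e where "e = e0 / 6"
    have e: "e > 0" using \<open>e0 > 0\<close> by (simp add: e_def)
    obtain d r e' where r: "r > 0" "e' \<le> e" "u \<in> ball d r"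
      and np: "\<not> directionally_porous_at (cone_approx f d r e') x"
      using np[OF e] by blast
    define A where "A = cone_approx f d r e'"
    \<comment> \<open>The room for moving \<open>u\<close> inside the cone around
      \<open>d\<close>.\<close>
    define \<rho> where "\<rho> = r - dist u d"
    have \<rho>: "\<rho> > 0" using r(3) by (simp add: \<rho>_def dist_commute)
    have ball: "u + q \<in> ball d r" if "norm q < \<rho>" for q
      using that unfolding \<rho>_def by (simp add: dist_norm) norm
    have A: "\<exists>y. \<forall>z\<in>ball d r. \<forall>t\<in>{0<..<r}. norm (f (a + t *\<^sub>R z) - f a - t *\<^sub>R y) \<le> e * t"
      if "a \<in> A" for a
    proof -
      have "e' * t \<le> e * t" if "t \<in> {0<..<r}" for t using r that by (simp add: mult_right_mono)
      with \<open>a \<in> A\<close> show ?thesis unfolding A_def cone_approx_def by (blast intro: order_trans)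
    qed
    obtain r1 where r1: "r1 > 0" "\<And>t. t \<in> {0<..<r1} \<Longrightarrow> norm (f (x + t *\<^sub>R u) - f x - t *\<^sub>R l) \<le> e * t"
      using l e unfolding has_hadamard_deriv_plus_iff by (metis centre_in_ball)
    \<comment> \<open>This scale is fixed before \<open>a\<close> and \<open>t\<close>; halving
      keeps it strictly below \<open>r\<close> and \<open>r1\<close>.\<close>
    define s where "s = min r r1 / 2"
    have s: "s > 0" "s < r" "s < r1" using r r1 by (auto simp: s_def)
    \<comment> \<open>Continuity is applied with error \<open>e * s\<close>, so that replacing
      \<open>f a\<close> by \<open>f x\<close> costs only \<open>e\<close> after division by
      \<open>s\<close>.\<close>
    obtain \<eta> where \<eta>: "\<eta> > 0" "\<And>a. dist a x < \<eta> \<Longrightarrow> dist (f a) (f x) < e * s"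
      using cont e s unfolding continuous_at_eps_delta by (metis mult_pos_pos)
    have close: "norm (y - l) \<le> 3 * e"
      if "dist a x < \<eta>" "dist a x < s * \<rho>"
        and y: "\<forall>z\<in>ball d r. \<forall>t\<in>{0<..<r}. norm (f (a + t *\<^sub>R z) - f a - t *\<^sub>R y) \<le> e * t" for a y
    proof -
      have "norm ((x - a) /\<^sub>R s) = dist a x / s"
        using s by (simp add: dist_norm norm_minus_commute divide_inverse mult.commute)
      also have "\<dots> < \<rho>" using that(2) s by (simp add: field_simps)
      finally have "norm ((x - a) /\<^sub>R s) < \<rho>" .
      from ball[OF this] have "norm (f (a + s *\<^sub>R (u + (x - a) /\<^sub>R s)) - f a - s *\<^sub>R y) \<le> e * s"
        using y s by auto
      moreover have "a + s *\<^sub>R (u + (x - a) /\<^sub>R s) = x + s *\<^sub>R u" using s by (simp add: algebra_simps)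
      ultimately have 1: "norm (f (x + s *\<^sub>R u) - f a - s *\<^sub>R y) \<le> e * s" by simp
      have 2: "norm (f (x + s *\<^sub>R u) - f x - s *\<^sub>R l) \<le> e * s" using r1 s by simp
      have 3: "norm (f a - f x) \<le> e * s" using \<eta>(2)[OF that(1)] by (simp add: dist_norm)
      have "s *\<^sub>R (y - l) = (f (x + s *\<^sub>R u) - f x - s *\<^sub>R l) + - (f (x + s *\<^sub>R u) - f a - s *\<^sub>R y) + - (f a - f x)"
        by (simp add: algebra_simps)
      moreover have "norm (\<dots>) \<le> e * s + e * s + e * s"
        by (intro norm_add3_le) (simp_all only: norm_minus_cancel 1 2 3)
      ultimately have "norm (s *\<^sub>R (y - l)) \<le> e * s + e * s + e * s" by simp
      then have "s * norm (y - l) \<le> s * (3 * e)" using s unfolding norm_scaleR by simp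
      then show ?thesis using s by simp
    qed
    obtain p0 where p0: "p0 > 0" "\<forall>\<^sub>F t in at_right 0.
        \<forall>z\<in>ball w p0. norm (f (x + t *\<^sub>R z) - f (x + t *\<^sub>R w)) \<le> e * t"
      using small_oscillation_atD[OF osc e] by blast
    \<comment> \<open>The bound \<open>p0\<close> controls the replacement of \<open>f a\<close> by
      \<open>f (x + t w)\<close>, and \<open>\<rho>\<close> keeps \<open>u + q\<close> in the cone
      at \<open>a\<close>.\<close>
    define p where "p = min p0 \<rho>"
    have p: "p > 0" using p0 \<rho> by (simp add: p_def)
    have meets: "\<forall>\<^sub>F t in at_right 0. \<exists>a\<in>A. dist (x + t *\<^sub>R w) a < p * t"
      unfolding A_def by (rule not_directionally_porous_at_meets[OF np False p])
    define M where "M = norm w + p"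
    have M: "M > 0" using p by (simp add: M_def add_nonneg_pos)
    \<comment> \<open>As \<open>M * t\<close> bounds \<open>dist a x\<close>, the three entries
      admit the step \<open>t\<close> at \<open>a\<close> and supply the two distance conditions of
      \<open>close\<close>.\<close>
    define b where "b = Min {r, \<eta> / M, s * \<rho> / M}"
    have b: "b > 0" using r \<eta> M s \<rho> by (simp add: b_def)
    have small: "\<forall>\<^sub>F t in at_right 0. 0 < t \<and> t < b"
      unfolding eventually_at_right_field using b by auto
    from small meets p0(2) show "\<forall>\<^sub>F t in at_right 0.
        norm (f (x + t *\<^sub>R (u + w)) - f (x + t *\<^sub>R w) - t *\<^sub>R l) \<le> e0 * t"
    proof eventually_elim
      case (elim t)
      then have t: "0 < t" "t < r" "M * t < \<eta>" "M * t < s * \<rho>"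
        using M by (auto simp: b_def field_simps)
      obtain a where a: "a \<in> A" "dist (x + t *\<^sub>R w) a < p * t" using elim by blast
      \<comment> \<open>Thus \<open>a = x + t (w - q)\<close> and
        \<open>x + t (u + w) = a + t (u + q)\<close>.\<close>
      define q where "q = (x + t *\<^sub>R w - a) /\<^sub>R t"
      have tq: "t *\<^sub>R q = x + t *\<^sub>R w - a" using t by (simp add: q_def)
      then have "norm (t *\<^sub>R q) < p * t" using a(2) by (simp add: dist_norm)
      then have q: "norm q < p" using t by (simp add: mult.commute)
      obtain y where y: "\<forall>z\<in>ball d r. \<forall>t\<in>{0<..<r}. norm (f (a + t *\<^sub>R z) - f a - t *\<^sub>R y) \<le> e * t"
        using A[OF a(1)] by blast
      have "dist a x = norm (t *\<^sub>R w - t *\<^sub>R q)" unfolding tq by (simp add: dist_norm)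
      also have "\<dots> \<le> norm (t *\<^sub>R w) + norm (t *\<^sub>R q)" by (rule norm_triangle_ineq4)
      also have "\<dots> \<le> M * t" using q t by (simp add: M_def algebra_simps)
      finally have "norm (y - l) \<le> 3 * e" using t by (intro close[OF _ _ y]) auto
      then have 1: "norm (t *\<^sub>R (y - l)) \<le> 3 * e * t" using t by (simp add: mult.commute)
      have "u + q \<in> ball d r" using q by (intro ball) (simp add: p_def)
      then have "norm (f (a + t *\<^sub>R (u + q)) - f a - t *\<^sub>R y) \<le> e * t" using y t by auto
      moreover have "a + t *\<^sub>R (u + q) = x + t *\<^sub>R (u + w)"
        by (simp add: scaleR_add_right tq)
      ultimately have 2: "norm (f (x + t *\<^sub>R (u + w)) - f a - t *\<^sub>R y) \<le> e * t" by simp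
      have "w - q \<in> ball w p0" using q by (simp add: p_def dist_norm)
      moreover have "x + t *\<^sub>R (w - q) = a" by (simp add: scaleR_diff_right tq)
      ultimately have 3: "norm (f a - f (x + t *\<^sub>R w)) \<le> e * t" using elim(3) by metis
      have "f (x + t *\<^sub>R (u + w)) - f (x + t *\<^sub>R w) - t *\<^sub>R l
          = (f (x + t *\<^sub>R (u + w)) - f a - t *\<^sub>R y) + (f a - f (x + t *\<^sub>R w)) + t *\<^sub>R (y - l)"
        by (simp add: algebra_simps)
      then have "norm (f (x + t *\<^sub>R (u + w)) - f (x + t *\<^sub>R w) - t *\<^sub>R l) \<le> e * t + e * t + 3 * e * t"
        using norm_add3_le[OF 2 3 1] by metis
      also have "\<dots> \<le> e0 * t" using e t by (simp add: e_def)
      finally show ?case .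
    qed
  qed
qed

section \<open>Closedness and linearity of the set of directions\<close>

text \<open>For directions near \<open>v\<close> the quotients are asymptotically close to those
  along \<open>v\<close>. Hence the derivatives \<open>L n\<close> form a Cauchy sequence, and
  completeness of the target provides the derivative along \<open>v\<close>.\<close>

lemma closed_hadamard_directions:
  fixes f :: "'a::real_normed_vector \<Rightarrow> 'b::banach"
  assumes osc: "small_oscillation_at f x"
  shows "closed (hadamard_directions f x)"
  unfolding closed_sequential_limits
proof (intro allI impI, elim conjE)
  fix V v assume V: "\<forall>n. V n \<in> hadamard_directions f x" and lim: "V \<longlonglongrightarrow> v"
  define q where "q z t = (f (x + t *\<^sub>R z) - f x) /\<^sub>R t" for z t
  from V obtain L where "\<And>n. has_hadamard_deriv_plus f x (V n) (L n)"
    unfolding hadamard_directions_def by (auto intro: that dest!: choice)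
  then have L: "(q (V n) \<longlongrightarrow> L n) (at_right 0)" for n
    unfolding q_def by (rule has_hadamard_deriv_plus_tendsto)
  \<comment> \<open>The quotients along \<open>v\<close> serve as a common reference, with no
    convergence assumed. The threshold in \<open>t\<close> may depend on \<open>n\<close>, as at
    most two indices are compared at once.\<close>
  have close: "\<exists>N. \<forall>n\<ge>N. \<forall>\<^sub>F t in at_right 0. dist (q (V n) t) (q v t) \<le> e" if e: "e > 0" for e
  proof -
    obtain p where p: "p > 0" "\<forall>\<^sub>F t in at_right 0.
        \<forall>z\<in>ball v p. norm (f (x + t *\<^sub>R z) - f (x + t *\<^sub>R v)) \<le> e * t"
      using small_oscillation_atD[OF osc e] by blast
    obtain N where N: "\<And>n. n \<ge> N \<Longrightarrow> dist (V n) v < p"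
      using lim p(1) unfolding lim_sequentially by blast
    have "\<forall>\<^sub>F t in at_right 0. dist (q (V n) t) (q v t) \<le> e" if "n \<ge> N" for n
      using p(2) eventually_at_right_less[of "0::real"]
    proof eventually_elim
      case (elim t)
      have "norm (f (x + t *\<^sub>R V n) - f (x + t *\<^sub>R v)) \<le> e * t"
        using elim N[OF that] by (simp add: dist_commute)
      moreover have "q (V n) t - q v t = (f (x + t *\<^sub>R V n) - f (x + t *\<^sub>R v)) /\<^sub>R t"
        by (simp add: q_def flip: scaleR_diff_right)
      then have "dist (q (V n) t) (q v t) = norm (f (x + t *\<^sub>R V n) - f (x + t *\<^sub>R v)) / t"
        using elim(2) by (simp add: dist_norm divide_inverse mult.commute)
      ultimately show ?case using elim(2) by (simp add: pos_divide_le_eq)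
    qed
    then show ?thesis by blast
  qed
  have "Cauchy L"
    unfolding Cauchy_def
  proof (intro allI impI)
    fix e :: real assume "e > 0"
    then obtain N where N: "\<And>n. n \<ge> N \<Longrightarrow> \<forall>\<^sub>F t in at_right 0. dist (q (V n) t) (q v t) \<le> e / 3"
      using close[of "e / 3"] by auto
    have "dist (L m) (L n) < e" if "m \<ge> N" "n \<ge> N" for m n
    proof -
      have "\<forall>\<^sub>F t in at_right 0. dist (q (V m) t) (q (V n) t) \<le> 2 * e / 3"
        using N[OF that(1)] N[OF that(2)]
      proof eventually_elim
        case (elim t)
        then show ?case using dist_triangle2[of "q (V m) t" "q (V n) t" "q v t"] by linarith
      qed
      then have "dist (L m) (L n) \<le> 2 * e / 3"
        by (intro tendsto_upperbound[OF tendsto_dist[OF L L]]) auto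
      with \<open>e > 0\<close> show ?thesis by simp
    qed
    then show "\<exists>M. \<forall>m\<ge>M. \<forall>n\<ge>M. dist (L m) (L n) < e" by blast
  qed
  then obtain l where l: "L \<longlonglongrightarrow> l" using Cauchy_convergent convergent_def by blast
  have "(q v \<longlongrightarrow> l) (at_right 0)"
    unfolding tendsto_iff
  proof (intro allI impI)
    fix e :: real assume "e > 0"
    then obtain N1 where N1: "\<And>n. n \<ge> N1 \<Longrightarrow> \<forall>\<^sub>F t in at_right 0. dist (q (V n) t) (q v t) \<le> e / 3"
      using close[of "e / 3"] by auto
    obtain N2 where N2: "\<And>n. n \<ge> N2 \<Longrightarrow> dist (L n) l < e / 3"
      using l \<open>e > 0\<close> unfolding lim_sequentially by (metis divide_pos_pos zero_less_numeral)
    define n where "n = max N1 N2"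
    have "\<forall>\<^sub>F t in at_right 0. dist (q (V n) t) (L n) < e / 3"
      using L[of n] \<open>e > 0\<close> by (intro tendstoD) simp_all
    moreover have "\<forall>\<^sub>F t in at_right 0. dist (q (V n) t) (q v t) \<le> e / 3"
      by (intro N1) (simp add: n_def)
    ultimately show "\<forall>\<^sub>F t in at_right 0. dist (q v t) l < e"
    proof eventually_elim
      case (elim t)
      have "dist (L n) l < e / 3" by (intro N2) (simp add: n_def)
      with elim show ?case
        using dist_triangle[of "q v t" l "q (V n) t"] dist_triangle[of "q (V n) t" l "L n"]
        by (simp add: dist_commute)
    qed
  qed
  then show "v \<in> hadamard_directions f x"
    unfolding hadamard_directions_def q_def using has_hadamard_deriv_plus_iff_tendsto[OF osc] by blast
qed

text \<open>The substitution of \<open>t * c\<close> for \<open>t\<close> preserves the one-sided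
  limit because \<open>c\<close> is positive; negative factors need the reversal of directions
  proved below.\<close>

lemma has_hadamard_deriv_plus_scaleR:
  assumes osc: "small_oscillation_at f x" and u: "has_hadamard_deriv_plus f x u l" and c: "c > 0"
  shows "has_hadamard_deriv_plus f x (c *\<^sub>R u) (c *\<^sub>R l)"
  unfolding has_hadamard_deriv_plus_iff_tendsto[OF osc]
proof -
  have "filterlim (\<lambda>t. t * c) (at_right 0) (at_right (0::real))"
    unfolding filterlim_at
  proof
    show "\<forall>\<^sub>F t in at_right 0. t * c \<in> {0<..} \<and> t * c \<noteq> 0"
      using eventually_at_right_less[of "0::real"] by eventually_elim (use c in auto)
    show "((\<lambda>t. t * c) \<longlongrightarrow> 0) (at_right 0)" by (intro tendsto_eq_intros) auto
  qed
  from tendsto_scaleR[OF tendsto_const[of c] filterlim_compose[OF has_hadamard_deriv_plus_tendsto[OF u] this]]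
  have "((\<lambda>t. c *\<^sub>R ((f (x + (t * c) *\<^sub>R u) - f x) /\<^sub>R (t * c))) \<longlongrightarrow> c *\<^sub>R l) (at_right 0)" .
  \<comment> \<open>Also valid at \<open>t = 0\<close>, where both sides are 0, so the two functions
    agree everywhere.\<close>
  moreover have "c * inverse (t * c) = inverse t" for t
    using c by (cases "t = 0") (auto simp: field_simps)
  ultimately show "((\<lambda>t. (f (x + t *\<^sub>R c *\<^sub>R u) - f x) /\<^sub>R t) \<longlongrightarrow> c *\<^sub>R l) (at_right 0)"
    by (simp del: inverse_mult_distrib)
qed

lemma linear_on_hadamard_directions:
  assumes osc: "small_oscillation_at f x"
    and trans: "\<And>u l w. has_hadamard_deriv_plus f x u l \<Longrightarrow>
      ((\<lambda>t. (f (x + t *\<^sub>R (u + w)) - f (x + t *\<^sub>R w)) /\<^sub>R t) \<longlongrightarrow> l) (at_right 0)"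
  shows "subspace (hadamard_directions f x)"
    and "linear_on_subspace (hadamard_directions f x) (hadamard_deriv_plus f x)"
proof -
  note iff = has_hadamard_deriv_plus_iff_tendsto[OF osc]
  have zero: "has_hadamard_deriv_plus f x 0 0"
    unfolding iff by simp
  \<comment> \<open>The increment to \<open>u + w\<close> is split at
    \<open>x + t w\<close>.\<close>
  have add: "has_hadamard_deriv_plus f x (u + w) (l + k)"
    if "has_hadamard_deriv_plus f x u l" "has_hadamard_deriv_plus f x w k" for u w l k
    using tendsto_add[OF trans[OF that(1), of w] has_hadamard_deriv_plus_tendsto[OF that(2)]]
    unfolding iff by (simp flip: scaleR_add_right)
  \<comment> \<open>With \<open>w = - u\<close> the translated increment is
    \<open>f x - f (x - t u)\<close>; a change of sign gives the derivative along
    \<open>- u\<close>.\<close>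
  have neg: "has_hadamard_deriv_plus f x (- u) (- l)" if "has_hadamard_deriv_plus f x u l" for u l
    using tendsto_minus[OF trans[OF that, of "- u"]]
    unfolding iff by (simp flip: scaleR_minus_right)
  have scale: "has_hadamard_deriv_plus f x (c *\<^sub>R u) (c *\<^sub>R l)"
    if u: "has_hadamard_deriv_plus f x u l" for c u l
  proof (cases c "0::real" rule: linorder_cases)
    case less
    then show ?thesis
      using neg[OF has_hadamard_deriv_plus_scaleR[OF osc u, of "- c"]] by simp
  next
    case greater
    then show ?thesis using has_hadamard_deriv_plus_scaleR[OF osc u] by blast
  qed (simp add: zero)
  have D: "has_hadamard_deriv_plus f x u (hadamard_deriv_plus f x u)"
    if "u \<in> hadamard_directions f x" for u
    using that hadamard_deriv_plus_eqI unfolding hadamard_directions_def by fastforce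
  show "subspace (hadamard_directions f x)"
    unfolding subspace_def hadamard_directions_def using zero add scale by blast
  show "linear_on_subspace (hadamard_directions f x) (hadamard_deriv_plus f x)"
    unfolding linear_on_subspace_def by (auto intro!: hadamard_deriv_plus_eqI add scale D)
qed

section \<open>The countable family and the exceptional set\<close>

text \<open>A radius below \<open>r / 2\<close> and a centre \<open>d\<close> closer to
  \<open>u\<close> than that radius keep the ball inside \<open>ball u r\<close>. This replaces
  arbitrary cones by countably many.\<close>

lemma ex_dense_cone:
  assumes "closure Q = UNIV" "r > 0"
  shows "\<exists>d\<in>Q. \<exists>n. 1 / real (Suc n) \<le> r \<and> u \<in> ball d (1 / real (Suc n)) \<and>
    ball d (1 / real (Suc n)) \<subseteq> ball u r"
proof -
  obtain n where n: "1 / real (Suc n) < r / 2"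
    using reals_Archimedean[of "r / 2"] assms(2) by (auto simp: inverse_eq_divide)
  obtain d where d: "d \<in> Q" "dist d u < 1 / real (Suc n)"
    using assms(1) closure_approachable[of u Q] by (metis UNIV_I zero_less_divide_1_iff of_nat_0_less_iff zero_less_Suc)
  have "ball d (1 / real (Suc n)) \<subseteq> ball u r"
  proof
    fix z assume "z \<in> ball d (1 / real (Suc n))"
    then show "z \<in> ball u r" using n d(2) dist_triangle[of u z d] unfolding mem_ball dist_commute[of u d] by linarith
  qed
  with n d assms(2) show ?thesis by (intro bexI[of _ d] exI[of _ n]) auto
qed

theorem theorem3p7:
  fixes f :: "'a::banach \<Rightarrow> 'b::banach" and G :: "'a set"
  assumes "separable_space (euclidean :: 'a topology)"
    and "open G"
  shows "\<exists>D. D \<subseteq> G \<and> sigma_directionally_porous D \<and>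
    (\<forall>x \<in> G - D.
       hadamard_directions f x = {} \<or>
       (closed (hadamard_directions f x) \<and> subspace (hadamard_directions f x) \<and>
        linear_on_subspace (hadamard_directions f x) (\<lambda>u. hadamard_deriv_plus f x u)))"
proof -
  obtain Q :: "'a set" where Q: "countable Q" "closure Q = UNIV"
    using assms(1) unfolding separable_space_def by auto
  \<comment> \<open>Axes come from \<open>Q\<close>, radii and constants from the naturals, which
    makes the family countable. Each set that is later tested for porosity must be a member.\<close>
  define F where "F =
     (\<lambda>(d, n, k). cone_bounded f d (1 / real (Suc n)) (real k)) ` (Q \<times> UNIV \<times> UNIV) \<union>
     (\<lambda>(d, n, k). cone_approx f d (1 / real (Suc n)) (1 / real (Suc k))) ` (Q \<times> UNIV \<times> UNIV) \<union>
     (\<lambda>(n, k). lipschitz_points f (1 / real (Suc n)) (real k)) ` UNIV"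
  have F: "countable F" "F \<noteq> {}" unfolding F_def using Q(1) by auto
  define D where "D = G \<inter> (\<Union>A\<in>F. {x \<in> A. directionally_porous_at A x})"
  have "closed (hadamard_directions f x) \<and> subspace (hadamard_directions f x) \<and>
        linear_on_subspace (hadamard_directions f x) (hadamard_deriv_plus f x)"
    if x: "x \<in> G - D" and ne: "hadamard_directions f x \<noteq> {}" for x
  proof -
    have np: "\<not> directionally_porous_at A x" if "A \<in> F" "x \<in> A" for A
      using x that unfolding D_def by blast
    obtain v l where v: "has_hadamard_deriv_plus f x v l"
      using ne unfolding hadamard_directions_def by blast
    obtain r where r: "r > 0" "\<forall>z\<in>ball v r. \<forall>t\<in>{0<..<r}. norm (f (x + t *\<^sub>R z) - f x - t *\<^sub>R l) \<le> 1 * t"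
      using v zero_less_one unfolding has_hadamard_deriv_plus_iff by blast
    obtain d n where d: "d \<in> Q" "1 / real (Suc n) \<le> r" "ball d (1 / real (Suc n)) \<subseteq> ball v r"
      using ex_dense_cone[OF Q(2) r(1)] by blast
    \<comment> \<open>The derivative inequality with \<open>e = 1\<close> gives the cone bound
      \<open>norm l + 1\<close>, here rounded up to an index.\<close>
    obtain k where k: "norm l + 1 \<le> real k" using real_arch_simple by blast
    have "norm (f (x + t *\<^sub>R z) - f x) \<le> real k * t"
      if "z \<in> ball d (1 / real (Suc n))" "t \<in> {0<..<1 / real (Suc n)}" for z t
    proof -
      have "norm (f (x + t *\<^sub>R z) - f x - t *\<^sub>R l) \<le> 1 * t" using r(2) d that by auto
      then have "norm (f (x + t *\<^sub>R z) - f x) \<le> (norm l + 1) * t"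
        using norm_triangle_sub[of "f (x + t *\<^sub>R z) - f x" "t *\<^sub>R l"] that by (simp add: algebra_simps)
      also have "\<dots> \<le> real k * t" using k that by (intro mult_right_mono) auto
      finally show ?thesis .
    qed
    then have "x \<in> cone_bounded f d (1 / real (Suc n)) (real k)" unfolding cone_bounded_def by blast
    moreover from this have "\<not> directionally_porous_at (cone_bounded f d (1 / real (Suc n)) (real k)) x"
      using d(1) by (intro np) (auto simp: F_def)
    ultimately obtain s K where sK: "s > 0" "K \<ge> 0" "x \<in> lipschitz_points f s K"
      using cone_bounded_imp_lipschitz[of x f d "1 / real (Suc n)" "real k"] by auto
    \<comment> \<open>The reals \<open>s\<close> and \<open>K\<close> must be rounded to indices of
      \<open>F\<close>; a smaller radius and a larger constant keep \<open>x\<close> in the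
      set.\<close>
    obtain n' where n': "1 / real (Suc n') < s"
      using reals_Archimedean[OF sK(1)] by (auto simp: inverse_eq_divide)
    obtain k' where k': "K \<le> real k'" using real_arch_simple by blast
    have lipF: "lipschitz_points f (1 / real (Suc n')) (real k') \<in> F"
      unfolding F_def by (intro UnI2 image_eqI[of _ _ "(n', k')"]) auto
    have lip: "x \<in> lipschitz_points f (1 / real (Suc n')) (real k')"
      unfolding lipschitz_points_def
    proof (intro CollectI ballI)
      fix h :: 'a assume "h \<in> ball 0 (1 / real (Suc n'))"
      then have "norm (f (x + h) - f x) \<le> K * norm h"
        using sK(3) n' unfolding lipschitz_points_def by auto
      also have "\<dots> \<le> real k' * norm h" using k' by (simp add: mult_right_mono)
      finally show "norm (f (x + h) - f x) \<le> real k' * norm h" .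
    qed
    then have osc: "small_oscillation_at f x"
      by (rule lipschitz_points_imp_small_oscillation) (use np[OF lipF lip] in auto)
    have cont: "isCont f x"
      unfolding continuous_at_eps_delta
    proof (intro allI impI)
      fix e :: real assume e: "e > 0"
      have "dist (f y) (f x) < e" if "dist y x < min s (e / (K + 1))" for y
      proof -
        have "y - x \<in> ball 0 s" using that by (simp add: dist_norm norm_minus_commute)
        then have "norm (f (x + (y - x)) - f x) \<le> K * norm (y - x)"
          using sK(3) unfolding lipschitz_points_def by blast
        also have "\<dots> \<le> (K + 1) * norm (y - x)" by (simp add: mult_right_mono)
        also have "\<dots> < e" using that sK(2) by (simp add: dist_norm field_simps)
        finally show ?thesis by (simp add: dist_norm)
      qed
      then show "\<exists>d>0. \<forall>y. dist y x < d \<longrightarrow> dist (f y) (f x) < e"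
        using sK e by (intro exI[of _ "min s (e / (K + 1))"]) auto
    qed
    \<comment> \<open>The derivative \<open>l\<close> serves as \<open>y\<close> at
      \<open>x\<close>, and the axis \<open>u\<close> is moved to a nearby point of \<open>Q\<close>
      so that the cone belongs to \<open>F\<close>.\<close>
    have approx: "\<exists>d r e'. r > 0 \<and> e' \<le> e \<and> u \<in> ball d r \<and> x \<in> cone_approx f d r e' \<and>
        \<not> directionally_porous_at (cone_approx f d r e') x"
      if u: "has_hadamard_deriv_plus f x u l" and "e > 0" for u l e
    proof -
      obtain j where j: "1 / real (Suc j) < e"
        using reals_Archimedean[OF \<open>e > 0\<close>] by (auto simp: inverse_eq_divide)
      obtain r where r: "r > 0"
        "\<forall>z\<in>ball u r. \<forall>t\<in>{0<..<r}. norm (f (x + t *\<^sub>R z) - f x - t *\<^sub>R l) \<le> 1 / real (Suc j) * t"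
        using u unfolding has_hadamard_deriv_plus_iff by (metis zero_less_divide_1_iff of_nat_0_less_iff zero_less_Suc)
      obtain d n where d: "d \<in> Q" "1 / real (Suc n) \<le> r" "u \<in> ball d (1 / real (Suc n))"
          "ball d (1 / real (Suc n)) \<subseteq> ball u r"
        using ex_dense_cone[OF Q(2) r(1)] by blast
      have "\<forall>z\<in>ball d (1 / real (Suc n)). \<forall>t\<in>{0<..<1 / real (Suc n)}.
          norm (f (x + t *\<^sub>R z) - f x - t *\<^sub>R l) \<le> 1 / real (Suc j) * t"
        using r(2) d(2,4) by (meson greaterThanLessThan_iff order_less_le_trans subsetD)
      then have "x \<in> cone_approx f d (1 / real (Suc n)) (1 / real (Suc j))"
        unfolding cone_approx_def by blast
      moreover from this have "\<not> directionally_porous_at (cone_approx f d (1 / real (Suc n)) (1 / real (Suc j))) x"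
        using d(1) by (intro np) (auto simp: F_def)
      ultimately show ?thesis using j d(3)
        by (intro exI[of _ d] exI[of _ "1 / real (Suc n)"] exI[of _ "1 / real (Suc j)"]) auto
    qed
    have trans: "((\<lambda>t. (f (x + t *\<^sub>R (u + w)) - f (x + t *\<^sub>R w)) /\<^sub>R t) \<longlongrightarrow> l) (at_right 0)"
      if u: "has_hadamard_deriv_plus f x u l" for u l w
      by (rule hadamard_deriv_translate[OF osc cont u approx[OF u]])
    show ?thesis
      using closed_hadamard_directions[OF osc] linear_on_hadamard_directions[OF osc trans] by blast
  qed
  then show ?thesis
    using sigma_directionally_porous_Union[OF F, of G] unfolding D_def[symmetric]
    by (intro exI[of _ D]) (auto simp: D_def)
qed

end
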